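(* Let $G$ be a finite group which is not an EPPO-group. Then the following conditions are equivalent: (i) the difference graph $\mathcal{D}(G)$ is a threshold graph; (ii) $\mathcal{D}(G)$ is a split graph; (iii) $G$ satisfies condition $\mathcal{B}$.
   Context: A finite group $G$ is an EPPO-group if the order of each element of $G$ is a prime power (the identity, of order $1$, being allowed). Difference graph: the power graph $\mathcal{P}(G)$ is the simple undirected graph with vertex set $G$ in which distinct $a,b$ are adjacent iff $a\in\langle b\rangle$ or $b\in\langle a\rangle$. The enhanced power graph $\mathcal{P}_E(G)$ is the simple undirected graph with vertex set $G$ in which distinct $a,b$ are adjacent iff $a,b\in\langle c\rangle$ for some $c\in G$. The difference graph $\mathcal{D}(G)$ is obtained from the graph $\mathcal{P}_E(G)-\mathcal{P}(G)$ (vertex set $G$; two vertices are adjacent iff they are adjacent in $\mathcal{P}_E(G)$ but not in $\mathcal{P}(G)$) by removing all isolated vertices. Condition $\mathcal{B}$: there are primes $p_1,\dots,p_k>2$ such that the order of every element of $G$ is $1$, or one of $2p_1,\dots,2p_k$, or of the form $p^{\alpha}$ with $p$ a prime and $\alpha\in\mathbb{N}$; and for all $1\le i,j\le k$ (possibly $i=j$), the intersection of any two distinct cyclic subgroups of $G$ of orders $2p_i$ and $2p_j$ respectively has cardinality exactly $2$. A graph is split if its vertex set is the disjoint union of two subsets, one inducing a complete graph and the other inducing an empty (edgeless) graph. A graph is threshold if it has no induced subgraph isomorphic to $C_4$ (cycle on 4 vertices), $P_4$ (path on 4 vertices) or $2K_2$ (disjoint union of two edges). *)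

theory Defs
  imports
    "HOL-Algebra.Elementary_Groups"
    "HOL-Algebra.Multiplicative_Group"
    "HOL-Number_Theory.Prime_Powers"
    "Graph_Theory.Pair_Digraph"
    "Graph_Theory.Digraph_Component"
    "Graph_Theory.Digraph_Isomorphism"
begin

text \<open>
  As in the Graph_Theory entry, a simple undirected graph is a loop-free symmetric digraph
  without parallel arcs (locale \<^locale>\<open>pair_graph\<close>): an edge between u and v is represented by
  the two arcs (u, v) and (v, u).
\<close>

definition power_graph :: "('a, 'b) monoid_scheme \<Rightarrow> 'a pair_pre_digraph" where
  "power_graph G = \<lparr> pverts = carrier G,
     parcs = {(a, b). a \<in> carrier G \<and> b \<in> carrier G \<and> a \<noteq> b \<and>
                (a \<in> generate G {b} \<or> b \<in> generate G {a})} \<rparr>"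

definition enhanced_power_graph :: "('a, 'b) monoid_scheme \<Rightarrow> 'a pair_pre_digraph" where
  "enhanced_power_graph G = \<lparr> pverts = carrier G,
     parcs = {(a, b). a \<in> carrier G \<and> b \<in> carrier G \<and> a \<noteq> b \<and>
                (\<exists>c\<in>carrier G. a \<in> generate G {c} \<and> b \<in> generate G {c})} \<rparr>"

definition remove_isolated :: "'a pair_pre_digraph \<Rightarrow> 'a pair_pre_digraph" where
  "remove_isolated \<Gamma> = \<lparr> pverts = {v \<in> pverts \<Gamma>. \<exists>u. (v, u) \<in> parcs \<Gamma>}, parcs = parcs \<Gamma> \<rparr>"

definition difference_graph :: "('a, 'b) monoid_scheme \<Rightarrow> 'a pair_pre_digraph" where
  "difference_graph G = remove_isolated
     \<lparr> pverts = carrier G, parcs = parcs (enhanced_power_graph G) - parcs (power_graph G) \<rparr>"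

definition split_graph :: "'a pair_pre_digraph \<Rightarrow> bool" where
  "split_graph \<Gamma> \<longleftrightarrow>
     (\<exists>A B. pverts \<Gamma> = A \<union> B \<and> A \<inter> B = {} \<and>
        (\<forall>u\<in>A. \<forall>v\<in>A. u \<noteq> v \<longrightarrow> (u, v) \<in> parcs \<Gamma>) \<and>
        (\<forall>u\<in>B. \<forall>v\<in>B. (u, v) \<notin> parcs \<Gamma>))"

definition cycle4 :: "nat pair_pre_digraph" where
  "cycle4 = \<lparr> pverts = {0, 1, 2, 3},
     parcs = {(0, 1), (1, 2), (2, 3), (3, 0)} \<union> {(1, 0), (2, 1), (3, 2), (0, 3)} \<rparr>"

definition path4 :: "nat pair_pre_digraph" where
  "path4 = \<lparr> pverts = {0, 1, 2, 3},
     parcs = {(0, 1), (1, 2), (2, 3)} \<union> {(1, 0), (2, 1), (3, 2)} \<rparr>"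

definition two_K2 :: "nat pair_pre_digraph" where
  "two_K2 = \<lparr> pverts = {0, 1, 2, 3}, parcs = {(0, 1), (2, 3)} \<union> {(1, 0), (3, 2)} \<rparr>"

definition has_induced :: "'a pair_pre_digraph \<Rightarrow> 'c pair_pre_digraph \<Rightarrow> bool" where
  "has_induced \<Gamma> F \<longleftrightarrow>
     (\<exists>H. induced_subgraph H (with_proj \<Gamma>) \<and> digraph_iso H (with_proj F))"

definition threshold_graph :: "'a pair_pre_digraph \<Rightarrow> bool" where
  "threshold_graph \<Gamma> \<longleftrightarrow>
     \<not> has_induced \<Gamma> cycle4 \<and> \<not> has_induced \<Gamma> path4 \<and> \<not> has_induced \<Gamma> two_K2"

text \<open>\<^const>\<open>primepow\<close> requires a positive exponent, so order 1 is listed separately.\<close>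

definition EPPO_group :: "('a, 'b) monoid_scheme \<Rightarrow> bool" where
  "EPPO_group G \<longleftrightarrow> group G \<and> finite (carrier G) \<and>
     (\<forall>x\<in>carrier G. group.ord G x = 1 \<or> primepow (group.ord G x))"

definition cyclic_subgroup :: "'a set \<Rightarrow> ('a, 'b) monoid_scheme \<Rightarrow> bool" where
  "cyclic_subgroup H G \<longleftrightarrow> subgroup H G \<and> cyclic_group (G\<lparr>carrier := H\<rparr>)"

definition condition_B :: "('a, 'b) monoid_scheme \<Rightarrow> bool" where
  "condition_B G \<longleftrightarrow>
     (\<exists>(k::nat) (p :: nat \<Rightarrow> nat).
        (\<forall>i\<in>{1..k}. prime (p i) \<and> p i > 2) \<and>
        (\<forall>x\<in>carrier G. group.ord G x = 1 \<or> (\<exists>i\<in>{1..k}. group.ord G x = 2 * p i) \<or>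
           primepow (group.ord G x)) \<and>
        (\<forall>i\<in>{1..k}. \<forall>j\<in>{1..k}. \<forall>H K.
           cyclic_subgroup H G \<and> cyclic_subgroup K G \<and> H \<noteq> K \<and>
           card H = 2 * p i \<and> card K = 2 * p j \<longrightarrow> card (H \<inter> K) = 2))"

lemma pair_graph_difference_graph:
  assumes "finite (carrier G)"
  shows "pair_graph (difference_graph G)"
proof -
  have "finite (parcs (difference_graph G))"
    by (rule finite_subset[of _ "carrier G \<times> carrier G"])
       (auto simp: difference_graph_def remove_isolated_def enhanced_power_graph_def assms)
  moreover have arcD: "u \<noteq> v" "u \<in> pverts (difference_graph G)" "v \<in> pverts (difference_graph G)"
    "(v, u) \<in> parcs (difference_graph G)"
    if "(u, v) \<in> parcs (difference_graph G)" for u v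
  proof -
    let ?E = "parcs (enhanced_power_graph G) - parcs (power_graph G)"
    have E: "parcs (difference_graph G) = ?E"
      "pverts (difference_graph G) = {v \<in> carrier G. \<exists>u. (v, u) \<in> ?E}"
      by (simp_all add: difference_graph_def remove_isolated_def)
    have uv: "(u, v) \<in> ?E" using that E by simp
    then have vu: "(v, u) \<in> ?E" and c: "u \<in> carrier G" "v \<in> carrier G" and n: "u \<noteq> v"
      by (auto simp: enhanced_power_graph_def power_graph_def)
    show "u \<noteq> v" by (fact n)
    show "u \<in> pverts (difference_graph G)" "v \<in> pverts (difference_graph G)"
      unfolding E using uv vu c by blast+
    show "(v, u) \<in> parcs (difference_graph G)" using vu E by simp
  qed
  moreover have "finite (pverts (difference_graph G))"
    using assms by (simp add: difference_graph_def remove_isolated_def)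
  ultimately show ?thesis
    by unfold_locales (auto simp: symmetric_def intro!: symI)
qed

lemma pair_graph_forbidden: "pair_graph cycle4" "pair_graph path4" "pair_graph two_K2"
  by (unfold_locales; auto simp: cycle4_def path4_def two_K2_def symmetric_def intro!: symI)+

lemma cyclic_subgroup_iff_generate:
  assumes "group G"
  shows "cyclic_subgroup H G \<longleftrightarrow> (\<exists>x\<in>carrier G. H = generate G {x})"
proof -
  interpret group G by fact
  have *: "generate (G\<lparr>carrier := H\<rparr>) {x} = generate G {x}" if "subgroup H G" "x \<in> H" for x
    using generate_consistent[of "{x}" H] that by simp
  show ?thesis
  proof
    assume "cyclic_subgroup H G"
    then obtain x where H: "subgroup H G" and x: "x \<in> H"
      and e: "subgroup_generated (G\<lparr>carrier := H\<rparr>) {x} = G\<lparr>carrier := H\<rparr>"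
      unfolding cyclic_subgroup_def cyclic_group_def by auto
    from e have "carrier (subgroup_generated (G\<lparr>carrier := H\<rparr>) {x}) = H"
      by simp
    then have "H = generate G {x}"
      using *[OF H x] x by (simp add: carrier_subgroup_generated)
    then show "\<exists>x\<in>carrier G. H = generate G {x}"
      using subgroup.mem_carrier[OF H x] by blast
  next
    assume "\<exists>x\<in>carrier G. H = generate G {x}"
    then obtain x where x: "x \<in> carrier G" "H = generate G {x}" by blast
    then have H: "subgroup H G" using generate_is_subgroup[of "{x}"] by simp
    have "x \<in> H" using x by (simp add: generate.incl)
    then show "cyclic_subgroup H G"
      unfolding cyclic_subgroup_def cyclic_group_def
      using H * x by (auto simp: subgroup_generated_def intro!: bexI[of _ x])
  qed
qed

end

theory Submission
  imports Defs
begin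

text \<open>
  Inside a cyclic group, one element generates another iff the orders divide; so arcs of the
  difference graph join elements of a common cyclic subgroup with incomparable orders.

  Threshold and split graphs contain neither an induced \<open>C\<^sub>4\<close> nor an induced \<open>2K\<^sub>2\<close>, and this
  already forces condition B. An element \<open>b\<close> of order greater than 2 has a twin \<open>b\<inverse>\<close> in the graph, so two
  distinct non-adjacent vertices with the common neighbour \<open>b\<close> lie on an induced \<open>C\<^sub>4\<close>. Any order other
  than 1, a prime power or \<open>2p\<close> admits two incomparable divisors greater than 2, hence a \<open>C\<^sub>4\<close>. Two
  cyclic subgroups of orders \<open>2p\<close> and \<open>2q\<close> with distinct involutions \<open>s\<close>, \<open>t\<close> and elements \<open>a\<close>, \<open>b\<close> of
  orders \<open>p\<close>, \<open>q\<close> give the arcs \<open>sa\<close>, \<open>tb\<close>: either these span a \<open>2K\<^sub>2\<close>, or one of \<open>sb\<close>, \<open>ta\<close> is an arc and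
  there is a \<open>C\<^sub>4\<close>.

  Conversely, under condition B all cyclic subgroups of order \<open>2p\<close> share one involution, and the
  difference graph is a star centred at it.
\<close>

section \<open>Induced subgraphs\<close>

text \<open>In \<open>with_proj\<close> an arc is the pair of its ends, so an isomorphism is
  determined by its action on vertices. Induced copies thus become plain vertex embeddings.\<close>

lemma has_induced_iff:
  assumes "pair_wf_digraph \<Gamma>" "pair_wf_digraph F"
  shows "has_induced \<Gamma> F \<longleftrightarrow>
    (\<exists>f. inj_on f (pverts F) \<and> f ` pverts F \<subseteq> pverts \<Gamma> \<and>
      (\<forall>u\<in>pverts F. \<forall>v\<in>pverts F. (f u, f v) \<in> parcs \<Gamma> \<longleftrightarrow> (u, v) \<in> parcs F))"
    (is "_ \<longleftrightarrow> (\<exists>f. ?emb f)")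
proof
  assume "has_induced \<Gamma> F"
  then obtain H hom where H: "verts H \<subseteq> pverts \<Gamma>" "tail H = fst" "head H = snd"
      "arcs H = {e \<in> parcs \<Gamma>. fst e \<in> verts H \<and> snd e \<in> verts H}"
    and hom: "pre_digraph.digraph_isomorphism H hom"
    and F: "with_proj F = app_iso hom H"
    unfolding has_induced_def induced_subgraph_def subgraph_def compatible_def digraph_iso_def
    by force
  define g where "g = iso_verts hom"
  \<comment> \<open>The isomorphism runs from \<open>H\<close> to \<open>F\<close>, whereas the
    embedding runs from \<open>F\<close> into the host graph.\<close>
  define f where "f = the_inv_into (verts H) g"
  have inj: "inj_on g (verts H)"
    using hom unfolding pre_digraph.digraph_isomorphism_def g_def by blast
  have vF: "pverts F = g ` verts H" and aF: "parcs F = iso_arcs hom ` arcs H"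
    using arg_cong[OF F, of verts] arg_cong[OF F, of arcs] by (simp_all add: g_def)
  \<comment> \<open>The records also agree in \<open>tail\<close> and \<open>head\<close>; this
    forces the arc map to apply \<open>g\<close> to both ends.\<close>
  have "iso_tail hom = fst" "iso_head hom = snd"
    using arg_cong[OF F, of tail] arg_cong[OF F, of head] by simp_all
  then have ia: "iso_arcs hom e = (g (fst e), g (snd e))" if "e \<in> arcs H" for e
    using hom that unfolding pre_digraph.digraph_isomorphism_def g_def H(2,3)
    by (auto intro: prod_eqI)
  have fg: "f (g x) = x" if "x \<in> verts H" for x
    using inj that by (simp add: f_def the_inv_into_f_f)
  have arcs: "(g x, g y) \<in> parcs F \<longleftrightarrow> (x, y) \<in> parcs \<Gamma>"
    if xy: "x \<in> verts H" "y \<in> verts H" for x y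
  proof
    assume "(g x, g y) \<in> parcs F"
    then obtain e where e: "e \<in> arcs H" "g x = g (fst e)" "g y = g (snd e)"
      unfolding aF using ia by force
    then show "(x, y) \<in> parcs \<Gamma>"
      using xy inj H(4) by (metis (no_types, lifting) inj_onD mem_Collect_eq prod.collapse)
  next
    assume "(x, y) \<in> parcs \<Gamma>"
    then have "(x, y) \<in> arcs H" using xy H by simp
    then show "(g x, g y) \<in> parcs F" unfolding aF using ia by force
  qed
  have "?emb f"
    unfolding vF using H(1) by (auto simp: fg arcs intro!: inj_onI)
  then show "\<exists>f. ?emb f" by - (rule exI)
next
  assume "\<exists>f. ?emb f"
  then obtain f where inj: "inj_on f (pverts F)" and sub: "f ` pverts F \<subseteq> pverts \<Gamma>"
    and arc: "\<forall>u\<in>pverts F. \<forall>v\<in>pverts F. (f u, f v) \<in> parcs \<Gamma> \<longleftrightarrow> (u, v) \<in> parcs F"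
    by (elim exE conjE)
  define g where "g = the_inv_into (pverts F) f"
  define H where "H = with_proj \<Gamma> \<restriction> (f ` pverts F)"
  define hom where "hom = \<lparr> iso_verts = g, iso_arcs = map_prod g g, iso_head = snd, iso_tail = fst \<rparr>"
  interpret \<Gamma>: pair_wf_digraph \<Gamma> by fact
  interpret F: pair_wf_digraph F by fact
  have gf: "g (f x) = x" if "x \<in> pverts F" for x
    using inj that by (simp add: g_def the_inv_into_f_f)
  have ind: "induced_subgraph H (with_proj \<Gamma>)"
    unfolding H_def by (rule \<Gamma>.induced_induce) (simp add: sub)
  have arcsH: "arcs H = map_prod f f ` parcs F"
  proof (intro equalityI subsetI)
    fix e assume "e \<in> arcs H"
    then obtain u v where uv: "e = (f u, f v)" "u \<in> pverts F" "v \<in> pverts F" "e \<in> parcs \<Gamma>"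
      by (cases e) (auto simp: H_def)
    then show "e \<in> map_prod f f ` parcs F" using arc by (auto intro!: image_eqI[of _ _ "(u, v)"])
  next
    fix e assume "e \<in> map_prod f f ` parcs F"
    then obtain u v where uv: "e = (f u, f v)" "(u, v) \<in> parcs F" by auto
    moreover from this have "u \<in> pverts F" "v \<in> pverts F"
      using F.arc_fst_in_verts F.arc_snd_in_verts by fastforce+
    ultimately show "e \<in> arcs H" using arc by (simp add: H_def)
  qed
  have "inj_on g (f ` pverts F)"
    by (rule inj_onI) (use gf in auto)
  moreover from this have "inj_on (map_prod g g) (arcs H)"
    by (auto simp: H_def inj_on_def)
  moreover have "wf_digraph H"
    using ind by (simp add: induced_subgraph_def subgraph_def)
  ultimately have "pre_digraph.digraph_isomorphism H hom"
    unfolding pre_digraph.digraph_isomorphism_def by (auto simp: H_def hom_def)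
  moreover have "with_proj F = app_iso hom H"
  proof -
    have "g ` f ` pverts F = pverts F" using gf by (simp add: image_image)
    moreover have "map_prod g g ` map_prod f f ` parcs F = (\<lambda>e. e) ` parcs F"
      unfolding image_image
      by (rule image_cong) (use gf F.arc_fst_in_verts F.arc_snd_in_verts in force)+
    ultimately show ?thesis
      unfolding with_proj_def app_iso_def arcsH by (simp add: H_def hom_def)
  qed
  ultimately show "has_induced \<Gamma> F"
    using ind unfolding has_induced_def digraph_iso_def by blast
qed

section \<open>Forbidden subgraphs, split graphs and stars\<close>

lemma pair_graph_arcD:
  assumes "pair_graph \<Gamma>" "(a, b) \<in> parcs \<Gamma>"
  shows "(b, a) \<in> parcs \<Gamma>" "a \<noteq> b" "a \<in> pverts \<Gamma>" "b \<in> pverts \<Gamma>"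
proof -
  interpret pair_graph \<Gamma> by fact
  show "(b, a) \<in> parcs \<Gamma>" "a \<noteq> b" "a \<in> pverts \<Gamma>" "b \<in> pverts \<Gamma>"
    using assms(2) arcs_symmetric no_loops arc_fst_in_verts arc_snd_in_verts by fastforce+
qed

lemmas pair_graph_wf =
  pair_graph.axioms(1)[THEN pair_digraph.axioms(1), THEN pair_fin_digraph.axioms(1)]

text \<open>Only the diagonals need explicit distinctness: without loops, \<open>a = c\<close> would
  be compatible with all the arc conditions.\<close>

lemma has_induced_cycle4I:
  assumes "pair_graph \<Gamma>"
    and "(a, b) \<in> parcs \<Gamma>" "(b, c) \<in> parcs \<Gamma>" "(c, d) \<in> parcs \<Gamma>" "(d, a) \<in> parcs \<Gamma>"
    and "(a, c) \<notin> parcs \<Gamma>" "(b, d) \<notin> parcs \<Gamma>" "a \<noteq> c" "b \<noteq> d"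
  shows "has_induced \<Gamma> cycle4"
proof -
  note D = pair_graph_arcD[OF assms(1)]
  define f :: "nat \<Rightarrow> _" where "f = (\<lambda>_. d)(0 := a, 1 := b, 2 := c)"
  have "f ` {0, 1, 2, 3} = {a, b, c, d}"
    by (auto simp: f_def)
  also have "\<dots> \<subseteq> pverts \<Gamma>"
    using D(3,4)[OF assms(2)] D(3,4)[OF assms(4)] by simp
  finally have verts: "f ` pverts cycle4 \<subseteq> pverts \<Gamma>"
    by (simp add: cycle4_def)
  have "(u, u) \<notin> parcs \<Gamma>" for u using D(2) by blast
  moreover have "(b, a) \<in> parcs \<Gamma>" "(c, b) \<in> parcs \<Gamma>" "(d, c) \<in> parcs \<Gamma>" "(a, d) \<in> parcs \<Gamma>"
    using D(1)[OF assms(2)] D(1)[OF assms(3)] D(1)[OF assms(4)] D(1)[OF assms(5)] by simp_all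
  moreover have "(c, a) \<notin> parcs \<Gamma>" "(d, b) \<notin> parcs \<Gamma>"
    using assms(6,7) D(1) by blast+
  moreover have "a \<noteq> c" "b \<noteq> d"
    using assms D(1) by metis+
  ultimately have "inj_on f (pverts cycle4)"
    "\<forall>u\<in>pverts cycle4. \<forall>v\<in>pverts cycle4. (f u, f v) \<in> parcs \<Gamma> \<longleftrightarrow> (u, v) \<in> parcs cycle4"
    using assms(2-) D(2)[OF assms(2)] D(2)[OF assms(3)] D(2)[OF assms(4)] D(2)[OF assms(5)]
    by (simp_all add: cycle4_def f_def inj_on_def)
  then show ?thesis
    unfolding has_induced_iff[OF pair_graph_wf[OF assms(1)] pair_graph_wf[OF pair_graph_forbidden(1)]]
    using verts by (intro exI[of _ f] conjI)
qed

text \<open>Distinctness is automatic: \<open>a = c\<close>, say, would turn the arc from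
  \<open>c\<close> to \<open>d\<close> into the excluded arc from \<open>a\<close> to
  \<open>d\<close>.\<close>

lemma has_induced_two_K2I:
  assumes "pair_graph \<Gamma>"
    and "(a, b) \<in> parcs \<Gamma>" "(c, d) \<in> parcs \<Gamma>"
    and "(a, c) \<notin> parcs \<Gamma>" "(a, d) \<notin> parcs \<Gamma>" "(b, c) \<notin> parcs \<Gamma>" "(b, d) \<notin> parcs \<Gamma>"
  shows "has_induced \<Gamma> two_K2"
proof -
  note D = pair_graph_arcD[OF assms(1)]
  define f :: "nat \<Rightarrow> _" where "f = (\<lambda>_. d)(0 := a, 1 := b, 2 := c)"
  have "f ` {0, 1, 2, 3} = {a, b, c, d}"
    by (auto simp: f_def)
  also have "\<dots> \<subseteq> pverts \<Gamma>"
    using D(3,4)[OF assms(2)] D(3,4)[OF assms(3)] by simp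
  finally have verts: "f ` pverts two_K2 \<subseteq> pverts \<Gamma>"
    by (simp add: two_K2_def)
  have "(u, u) \<notin> parcs \<Gamma>" for u using D(2) by blast
  moreover have "(b, a) \<in> parcs \<Gamma>" "(d, c) \<in> parcs \<Gamma>"
    using D(1)[OF assms(2)] D(1)[OF assms(3)] by simp_all
  moreover have "(c, a) \<notin> parcs \<Gamma>" "(d, a) \<notin> parcs \<Gamma>" "(c, b) \<notin> parcs \<Gamma>" "(d, b) \<notin> parcs \<Gamma>"
    using assms(4-7) D(1) by blast+
  moreover have "a \<noteq> c" "a \<noteq> d" "b \<noteq> c" "b \<noteq> d"
    using assms D(1) by metis+
  ultimately have "inj_on f (pverts two_K2)"
    "\<forall>u\<in>pverts two_K2. \<forall>v\<in>pverts two_K2. (f u, f v) \<in> parcs \<Gamma> \<longleftrightarrow> (u, v) \<in> parcs two_K2"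
    using assms(2-) D(2)[OF assms(2)] D(2)[OF assms(3)]
    by (simp_all add: two_K2_def f_def inj_on_def)
  then show ?thesis
    unfolding has_induced_iff[OF pair_graph_wf[OF assms(1)] pair_graph_wf[OF pair_graph_forbidden(3)]]
    using verts by (intro exI[of _ f] conjI)
qed

text \<open>Each diagonal of a 4-cycle has an end in the independent part, yet ends of different
  diagonals are adjacent. Dually, each edge of \<open>two_K2\<close> has an end in the clique, yet
  ends of different edges are not adjacent.\<close>

lemma split_graph_no_induced:
  assumes "pair_graph \<Gamma>" "split_graph \<Gamma>"
  shows "\<not> has_induced \<Gamma> cycle4" "\<not> has_induced \<Gamma> two_K2"
proof -
  note iff = has_induced_iff[OF pair_graph_wf[OF assms(1)] pair_graph_wf]
  from assms(2) obtain A B where AB: "pverts \<Gamma> = A \<union> B"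
      "\<forall>u\<in>A. \<forall>v\<in>A. u \<noteq> v \<longrightarrow> (u, v) \<in> parcs \<Gamma>"
      "\<forall>u\<in>B. \<forall>v\<in>B. (u, v) \<notin> parcs \<Gamma>"
    unfolding split_graph_def by (elim exE conjE)
  show "\<not> has_induced \<Gamma> cycle4"
  proof
    assume "has_induced \<Gamma> cycle4"
    then obtain f :: "nat \<Rightarrow> _" where f: "inj_on f {0, 1, 2, 3}" "f ` {0, 1, 2, 3} \<subseteq> A \<union> B"
        "\<forall>u\<in>{0, 1, 2, 3}. \<forall>v\<in>{0, 1, 2, 3}. (f u, f v) \<in> parcs \<Gamma> \<longleftrightarrow> (u, v) \<in> parcs cycle4"
      unfolding iff[OF pair_graph_forbidden(1)] AB(1) by (auto simp only: cycle4_def pair_pre_digraph.select_convs)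
    have edge: "(f 0, f 1) \<in> parcs \<Gamma>" "(f 0, f 3) \<in> parcs \<Gamma>" "(f 2, f 1) \<in> parcs \<Gamma>" "(f 2, f 3) \<in> parcs \<Gamma>"
      and nonedge: "(f 0, f 2) \<notin> parcs \<Gamma>" "(f 1, f 3) \<notin> parcs \<Gamma>"
      using f(3) by (simp_all add: cycle4_def)
    have ne: "f 0 \<noteq> f 2" "f 1 \<noteq> f 3"
      using f(1) by (simp_all add: inj_on_def)
    have mem: "f 0 \<in> A \<union> B" "f 1 \<in> A \<union> B" "f 2 \<in> A \<union> B" "f 3 \<in> A \<union> B"
      using f(2) by simp_all
    have "f 0 \<in> B \<or> f 2 \<in> B" "f 1 \<in> B \<or> f 3 \<in> B"
      using mem AB(2) nonedge ne by blast+
    then show False using AB(3) edge by blast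
  qed
  show "\<not> has_induced \<Gamma> two_K2"
  proof
    assume "has_induced \<Gamma> two_K2"
    then obtain f :: "nat \<Rightarrow> _" where f: "inj_on f {0, 1, 2, 3}" "f ` {0, 1, 2, 3} \<subseteq> A \<union> B"
        "\<forall>u\<in>{0, 1, 2, 3}. \<forall>v\<in>{0, 1, 2, 3}. (f u, f v) \<in> parcs \<Gamma> \<longleftrightarrow> (u, v) \<in> parcs two_K2"
      unfolding iff[OF pair_graph_forbidden(3)] AB(1) by (auto simp only: two_K2_def pair_pre_digraph.select_convs)
    have edge: "(f 0, f 1) \<in> parcs \<Gamma>" "(f 2, f 3) \<in> parcs \<Gamma>"
      and nonedge: "(f 0, f 2) \<notin> parcs \<Gamma>" "(f 0, f 3) \<notin> parcs \<Gamma>" "(f 1, f 2) \<notin> parcs \<Gamma>" "(f 1, f 3) \<notin> parcs \<Gamma>"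
      using f(3) by (simp_all add: two_K2_def)
    have ne: "f 0 \<noteq> f 2" "f 0 \<noteq> f 3" "f 1 \<noteq> f 2" "f 1 \<noteq> f 3"
      using f(1) by (simp_all add: inj_on_def)
    have mem: "f 0 \<in> A \<union> B" "f 1 \<in> A \<union> B" "f 2 \<in> A \<union> B" "f 3 \<in> A \<union> B"
      using f(2) by simp_all
    have "f 0 \<in> A \<or> f 1 \<in> A" "f 2 \<in> A \<or> f 3 \<in> A"
      using mem AB(3) edge by blast+
    then show False using AB(2) nonedge ne by blast
  qed
qed

lemma star_split_graph:
  assumes "pair_graph \<Gamma>" and star: "\<And>u v. (u, v) \<in> parcs \<Gamma> \<Longrightarrow> u = t \<or> v = t"
  shows "split_graph \<Gamma>"
  unfolding split_graph_def
  \<comment> \<open>The intersection with \<open>{t}\<close> allows for a centre \<open>t\<close>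
    that is not a vertex.\<close>
  by (rule exI[of _ "pverts \<Gamma> \<inter> {t}"], rule exI[of _ "pverts \<Gamma> - {t}"]) (use star in blast)

text \<open>All three forbidden graphs contain the disjoint edges 01 and 23, whereas any two edges
  of a star meet in \<open>t\<close>.\<close>

lemma star_threshold_graph:
  assumes "pair_graph \<Gamma>" and star: "\<And>u v. (u, v) \<in> parcs \<Gamma> \<Longrightarrow> u = t \<or> v = t"
  shows "threshold_graph \<Gamma>"
proof -
  have "\<not> has_induced \<Gamma> F" if F: "pair_graph F" "(0, 1) \<in> parcs F" "(2, 3) \<in> parcs F"
    for F :: "nat pair_pre_digraph"
  proof
    assume "has_induced \<Gamma> F"
    then obtain f where f: "inj_on f (pverts F)"
        "\<forall>u\<in>pverts F. \<forall>v\<in>pverts F. (f u, f v) \<in> parcs \<Gamma> \<longleftrightarrow> (u, v) \<in> parcs F"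
      unfolding has_induced_iff[OF pair_graph_wf[OF assms(1)] pair_graph_wf[OF F(1)]] by blast
    have v: "0 \<in> pverts F" "1 \<in> pverts F" "2 \<in> pverts F" "3 \<in> pverts F"
      using pair_graph_arcD[OF F(1)] F(2,3) by blast+
    have "f 0 = t \<or> f 1 = t" "f 2 = t \<or> f 3 = t"
      using star f(2) v F(2,3) by blast+
    moreover have "f 0 \<noteq> f 2" "f 0 \<noteq> f 3" "f 1 \<noteq> f 2" "f 1 \<noteq> f 3"
      using inj_on_eq_iff[OF f(1)] v by simp_all
    ultimately show False by auto
  qed
  then show ?thesis
    unfolding threshold_graph_def using pair_graph_forbidden
    by (auto simp: cycle4_def path4_def two_K2_def)
qed

section \<open>Element orders\<close>

text \<open>Since \<open>n\<close> is not a power of 2, it has an odd prime factor \<open>p\<close>;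
  split off its full power, \<open>n = p ^ k * m\<close>. If \<open>m > 2\<close>, the coprime
  factors \<open>p ^ k\<close> and \<open>m\<close> serve.\<close>

lemma two_incomparable_divisors:
  fixes n :: nat
  assumes "n > 0" "n \<noteq> 1" "\<not> primepow n" "\<not> (\<exists>p>2. prime p \<and> n = 2 * p)"
  obtains d e where "d dvd n" "e dvd n" "d > 2" "e > 2" "\<not> d dvd e" "\<not> e dvd d"
proof -
  obtain p where p: "prime p" "p \<noteq> 2" "p dvd n"
  proof -
    obtain m where m: "n = 2 ^ multiplicity 2 n * m" "\<not> 2 dvd m"
      by (rule multiplicity_decompose'[of n 2]) (use assms(1) in auto)
    have "m \<noteq> 1"
    proof
      assume "m = 1"
      then have "n = 2 ^ multiplicity 2 n" using m(1) by simp
      moreover from this have "multiplicity 2 n > 0" using assms(2) by (metis gr0I power_0)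
      ultimately show False using assms(3) primepow_prime_power two_is_prime_nat by metis
    qed
    then obtain p where "prime p" "p dvd m" using prime_factor_nat by blast
    then show ?thesis using that m by (metis dvd_mult)
  qed
  define k where "k = multiplicity p n"
  obtain m where m: "\<not> p dvd m" "n = p ^ k * m"
    unfolding k_def by (rule multiplicity_decompose'[of n p]) (use assms(1) p(1) in auto)
  have k: "k > 0" using m p by (cases k) auto
  have p3: "p > 2" using p prime_ge_2_nat[of p] by linarith
  have pk: "p ^ k \<ge> p" using k p3 by (simp add: self_le_power)
  have m1: "m \<noteq> 1" using m k p(1) assms(3) by auto
  have m0: "m \<noteq> 0" using m(1) by (metis dvd_0_right)
  have cop: "coprime (p ^ k) m" using m p(1) by (simp add: prime_imp_coprime)
  show thesis
  proof (cases "m = 2")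
    \<comment> \<open>The divisor 2 is too small, so \<open>2 * p\<close> replaces it; it is not a
      multiple of \<open>p ^ k\<close> because \<open>n \<noteq> 2 * p\<close> gives
      \<open>k \<ge> 2\<close>.\<close>
    case True
    then have "k \<noteq> 1" using assms(4) m p(1) p3 by auto
    with k have "p ^ 2 dvd p ^ k" by (intro le_imp_power_dvd) auto
    moreover have "\<not> p ^ 2 dvd 2 * p"
      using p3 by (auto simp: power2_eq_square dest: dvd_imp_le)
    ultimately have "\<not> p ^ k dvd 2 * p" by (metis dvd_trans)
    moreover have "\<not> 2 * p dvd p ^ k"
      using cop True p3 by (auto dest: dvd_mult_left simp: coprime_right_2_iff_odd)
    moreover have "2 * p dvd n" using m(2) True k by (simp add: mult.commute)
    ultimately show thesis using that[of "p ^ k" "2 * p"] m(2) pk p3 by simp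
  next
    case False
    then have "m > 2" using m0 m1 by linarith
    moreover have "\<not> p ^ k dvd m" "\<not> m dvd p ^ k"
      using cop \<open>m > 2\<close> pk p3 coprime_absorb_left[of "p ^ k" m] coprime_absorb_right[of m "p ^ k"]
      by auto
    ultimately show thesis using that[of "p ^ k" m] m(2) pk p3 by simp
  qed
qed

lemma dvd_double_prime_nat:
  fixes p d :: nat
  assumes "prime p" "d dvd 2 * p"
  shows "d \<in> {1, 2, p, 2 * p}"
proof -
  obtain x y where xy: "d = x * y" "x dvd 2" "y dvd p" using assms(2) division_decomp by blast
  have "x = 1 \<or> x = 2" using xy(2) two_is_prime_nat by (simp add: prime_nat_iff)
  moreover have "y = 1 \<or> y = p" using xy(3) assms(1) by (simp add: prime_nat_iff)
  ultimately show ?thesis using xy(1) by auto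
qed

section \<open>Orders inside a cyclic subgroup\<close>

context group
begin

lemma generate_subset_iff:
  assumes "a \<in> carrier G" "b \<in> carrier G"
  shows "generate G {a} \<subseteq> generate G {b} \<longleftrightarrow> a \<in> generate G {b}"
  using assms generate_is_subgroup[of "{b}"] generate_subgroup_incl[of "{a}"] generate.incl[of a "{a}"]
  by blast

lemma ord_dvd_if_in_generate:
  assumes "finite (carrier G)" "c \<in> carrier G" "u \<in> generate G {c}"
  shows "ord u dvd ord c"
proof -
  obtain i where "u = c [^] (i::nat)"
    using assms generate_pow_on_finite_carrier by blast
  then show ?thesis
    using assms(2) by (metis dvd_triv_left nat_pow_closed nat_pow_pow pow_eq_id mult.commute)
qed

text \<open>With \<open>u\<close> and \<open>v\<close> the powers of \<open>c\<close> with exponents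
  \<open>i\<close> and \<open>j\<close>, and \<open>n = ord c\<close>, divisibility of the orders
  makes \<open>gcd n j\<close> divide \<open>i\<close>. By Bezout, \<open>i\<close> is then a
  multiple of \<open>j\<close> modulo \<open>n\<close>.\<close>

lemma in_generate_iff_ord_dvd:
  assumes fin: "finite (carrier G)" and c: "c \<in> carrier G"
    and u: "u \<in> generate G {c}" and v: "v \<in> generate G {c}"
  shows "u \<in> generate G {v} \<longleftrightarrow> ord u dvd ord v"
proof
  have vG: "v \<in> carrier G" using v c generate_in_carrier by blast
  show "u \<in> generate G {v} \<Longrightarrow> ord u dvd ord v"
    using ord_dvd_if_in_generate fin vG by blast
  assume dvd: "ord u dvd ord v"
  define n where "n = ord c"
  have n: "n > 0" using ord_ge_1[OF fin c] by (simp add: n_def)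
  obtain i j where i: "u = c [^] (i::nat)" and j: "v = c [^] (j::nat)"
    using u v fin c generate_pow_on_finite_carrier by blast
  have ou: "ord (c [^] l) = n div gcd n l" for l
    using ord_pow_gen[OF c, of l] n by (auto simp: n_def)
  have "n div gcd n i dvd n div gcd n j"
    using dvd unfolding i j ou .
  then obtain m where "n div gcd n j = (n div gcd n i) * m" by blast
  then have "n div gcd n i * (gcd n j * m) = n div gcd n i * gcd n i"
    by (metis dvd_div_mult_self gcd_dvd1 mult.assoc mult.commute)
  moreover have "n div gcd n i \<noteq> 0" using n by (simp add: dvd_div_eq_0_iff)
  ultimately have "gcd n i = gcd n j * m" by (metis mult_left_cancel)
  then have "gcd n j dvd gcd n i" by simp
  then have "gcd n j dvd i" by auto
  \<comment> \<open>The move to integers accommodates negative Bezout coefficients.\<close>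
  then have "gcd (int j) (int n) dvd int i"
    by (simp add: gcd.commute)
  then obtain q where q: "int i = gcd (int j) (int n) * q" by blast
  obtain x y where "x * int j + y * int n = gcd (int j) (int n)"
    using bezout_int by blast
  then have "int i = int j * (x * q) + int n * (y * q)"
    using q by (simp add: algebra_simps flip: distrib_left)
  then have "int n dvd int i - int j * (x * q)" by simp
  then have "c [^] (int j * (x * q)) = c [^] int i"
    using int_pow_eq[OF c] unfolding n_def by blast
  moreover have "u = c [^] int i" "v = c [^] int j"
    by (simp_all add: i j int_pow_int)
  ultimately have "u = v [^] (x * q)"
    using int_pow_pow[OF c, of "int j" "x * q"] by simp
  then show "u \<in> generate G {v}"
    using generate_pow[OF vG] by blast
qed

text \<open>Equal orders make \<open>u\<close> a power of \<open>v\<close>; its exponent is odd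
  because \<open>u\<close> is not the identity, and an odd power of an involution is that
  involution.\<close>

lemma involution_unique:
  assumes fin: "finite (carrier G)" and c: "c \<in> carrier G"
    and uv: "u \<in> generate G {c}" "v \<in> generate G {c}" "ord u = 2" "ord v = 2"
  shows "u = v"
proof -
  have v: "v \<in> carrier G" using uv(2) c generate_in_carrier by blast
  have "u \<in> generate G {v}"
    using in_generate_iff_ord_dvd[OF fin c uv(1,2)] uv(3,4) by simp
  then obtain i where i: "u = v [^] (i::nat)"
    using generate_pow_on_finite_carrier[OF fin v] by blast
  have "odd i"
    using i v uv(3,4) pow_eq_id[OF v, of i] by auto
  then obtain k where "i = 2 * k + 1" by (auto elim: oddE)
  moreover have "v [^] (2 * k) = \<one>" using pow_eq_id[OF v] uv(4) by simp
  ultimately show ?thesis using i v by (simp flip: nat_pow_mult)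
qed

section \<open>The difference graph\<close>

text \<open>Removing isolated vertices keeps all arcs, and inside a common cyclic subgroup
  non-adjacency in the power graph is incomparability of orders. Incomparability also yields
  \<open>u \<noteq> v\<close>.\<close>

lemma difference_graph_arc_iff:
  assumes "finite (carrier G)"
  shows "(u, v) \<in> parcs (difference_graph G) \<longleftrightarrow>
    (\<exists>c\<in>carrier G. u \<in> generate G {c} \<and> v \<in> generate G {c} \<and>
      \<not> ord u dvd ord v \<and> \<not> ord v dvd ord u)"
proof -
  have arc: "(u, v) \<in> parcs (difference_graph G) \<longleftrightarrow> u \<in> carrier G \<and> v \<in> carrier G \<and> u \<noteq> v \<and>
     (\<exists>c\<in>carrier G. u \<in> generate G {c} \<and> v \<in> generate G {c}) \<and>
     u \<notin> generate G {v} \<and> v \<notin> generate G {u}"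
    by (auto simp: difference_graph_def remove_isolated_def enhanced_power_graph_def power_graph_def)
  have dvd: "u \<in> generate G {v} \<longleftrightarrow> ord u dvd ord v" "v \<in> generate G {u} \<longleftrightarrow> ord v dvd ord u"
    if "c \<in> carrier G" "u \<in> generate G {c}" "v \<in> generate G {c}" for c
    by (rule in_generate_iff_ord_dvd[OF assms that(1,2,3)], rule in_generate_iff_ord_dvd[OF assms that(1,3,2)])
  show ?thesis (is "_ \<longleftrightarrow> ?R")
  proof
    assume "(u, v) \<in> parcs (difference_graph G)"
    then obtain c where c: "c \<in> carrier G" "u \<in> generate G {c}" "v \<in> generate G {c}"
        "u \<notin> generate G {v}" "v \<notin> generate G {u}"
      unfolding arc by (elim conjE bexE)
    then show ?R using dvd[OF c(1-3)] by (intro bexI[of _ c]) simp_all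
  next
    assume ?R
    then obtain c where c: "c \<in> carrier G" "u \<in> generate G {c}" "v \<in> generate G {c}"
        and nd: "\<not> ord u dvd ord v" "\<not> ord v dvd ord u"
      by (elim conjE bexE)
    have "u \<in> carrier G" "v \<in> carrier G"
      using c generate_in_carrier[of "{c}"] by simp_all
    moreover have "u \<noteq> v" using nd by (metis dvd_refl)
    moreover have "u \<notin> generate G {v}" "v \<notin> generate G {u}"
      using dvd[OF c] nd by simp_all
    ultimately show "(u, v) \<in> parcs (difference_graph G)"
      using arc c(1-3) by blast
  qed
qed

lemma difference_graph_arcI:
  assumes "finite (carrier G)" "c \<in> carrier G" "u \<in> generate G {c}" "v \<in> generate G {c}"
    and "\<not> ord u dvd ord v" "\<not> ord v dvd ord u"
  shows "(u, v) \<in> parcs (difference_graph G)"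
  unfolding difference_graph_arc_iff[OF assms(1)] using assms(2-) by (intro bexI[of _ c] conjI)

text \<open>Applied to an element and its inverse, and to two involutions.\<close>

lemma difference_graph_no_arc_if_ord_eq:
  assumes "finite (carrier G)" "ord u = ord v"
  shows "(u, v) \<notin> parcs (difference_graph G)"
  unfolding difference_graph_arc_iff[OF assms(1)] assms(2) by simp

section \<open>Consequences of excluding 4-cycles\<close>

lemma inv_neq_self_if_ord_gt_2:
  assumes "x \<in> carrier G" "ord x > 2"
  shows "x \<noteq> inv x"
proof
  assume "x = inv x"
  then have "x [^] (2::nat) = \<one>" using assms r_inv[of x] by (simp add: numeral_2_eq_2)
  then have "ord x dvd 2" using pow_eq_id[OF assms(1)] by simp
  then show False using assms(2) by (auto dest: dvd_imp_le)
qed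

lemma in_generate_pow_ord_div:
  assumes fin: "finite (carrier G)" and x: "x \<in> carrier G" and d: "d dvd ord x"
  shows "x [^] (ord x div d) \<in> generate G {x}" "ord (x [^] (ord x div d)) = d"
proof -
  have "ord x > 0" using ord_ge_1[OF fin x] by simp
  with d have "ord x div d dvd ord x" "ord x div d \<noteq> 0" "ord x div (ord x div d) = d"
    by (auto elim!: dvdE)
  then show "ord (x [^] (ord x div d)) = d" using ord_pow[OF x] by simp
  show "x [^] (ord x div d) \<in> generate G {x}"
    unfolding generate_pow_on_finite_carrier[OF fin x] by (rule CollectI) auto
qed

text \<open>The cycle is \<open>s\<close>, \<open>b\<close>, \<open>t\<close>,
  \<open>inv b\<close>.\<close>

lemma common_neighbour_imp_cycle4:
  assumes fin: "finite (carrier G)"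
    and arcs: "(s, b) \<in> parcs (difference_graph G)" "(t, b) \<in> parcs (difference_graph G)"
    and st: "s \<noteq> t" "(s, t) \<notin> parcs (difference_graph G)" and "ord b > 2"
  shows "has_induced (difference_graph G) cycle4"
proof -
  note pg = pair_graph_difference_graph[OF fin]
  \<comment> \<open>\<open>inv b\<close> has the order of \<open>b\<close> and lies in every cyclic
    subgroup containing \<open>b\<close>, so it inherits all neighbours of \<open>b\<close>.\<close>
  have b_inv: "b \<in> carrier G \<and> (u, inv b) \<in> parcs (difference_graph G)"
    if ub: "(u, b) \<in> parcs (difference_graph G)" for u
  proof -
    from ub obtain c where c: "c \<in> carrier G" "u \<in> generate G {c}" "b \<in> generate G {c}"
        and nd: "\<not> ord u dvd ord b" "\<not> ord b dvd ord u"
      unfolding difference_graph_arc_iff[OF fin] by (elim bexE conjE)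
    have b: "b \<in> carrier G" using generate_in_carrier[of "{c}" b] c by simp
    have "inv b \<in> generate G {c}"
      using generate_m_inv_closed[of "{c}" b] c by simp
    then show ?thesis
      using b nd by (intro conjI difference_graph_arcI[OF fin c(1,2)]) simp_all
  qed
  then have b: "b \<in> carrier G" using arcs(1) by simp
  have "(b, inv b) \<notin> parcs (difference_graph G)"
    using difference_graph_no_arc_if_ord_eq[OF fin] b by simp
  then show ?thesis
    using b_inv[OF arcs(1)] b_inv[OF arcs(2)] arcs st inv_neq_self_if_ord_gt_2[OF b \<open>ord b > 2\<close>]
    by (intro has_induced_cycle4I[OF pg, of s b t "inv b"] pair_graph_arcD(1)[OF pg, of t b]
        pair_graph_arcD(1)[OF pg, of s "inv b"]) simp_all
qed

text \<open>Otherwise powers \<open>a\<close>, \<open>b\<close> of \<open>x\<close> have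
  incomparable orders above 2. Then \<open>a\<close> and \<open>inv a\<close> are distinct,
  non-adjacent neighbours of \<open>b\<close>.\<close>

lemma orders_if_no_cycle4:
  assumes fin: "finite (carrier G)" and C4: "\<not> has_induced (difference_graph G) cycle4"
    and x: "x \<in> carrier G"
  shows "ord x = 1 \<or> primepow (ord x) \<or> (\<exists>p>2. prime p \<and> ord x = 2 * p)"
proof (rule ccontr)
  assume neg: "\<not> ?thesis"
  have pos: "ord x > 0" using ord_ge_1[OF fin x] by simp
  obtain d e where de: "d dvd ord x" "e dvd ord x" "d > 2" "e > 2" "\<not> d dvd e" "\<not> e dvd d"
    by (rule two_incomparable_divisors[OF pos]) (use neg in auto)
  define a b where "a = x [^] (ord x div d)" and "b = x [^] (ord x div e)"
  have a: "a \<in> generate G {x}" "ord a = d" and b: "b \<in> generate G {x}" "ord b = e"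
    unfolding a_def b_def using in_generate_pow_ord_div[OF fin x] de(1,2) by simp_all
  have aG: "a \<in> carrier G" using a_def x by simp
  have "inv a \<in> generate G {x}"
    using generate_m_inv_closed[of "{x}" a] a x by simp
  then have "(inv a, b) \<in> parcs (difference_graph G)"
    using a b aG de by (intro difference_graph_arcI[OF fin x]) simp_all
  moreover have "(a, b) \<in> parcs (difference_graph G)"
    using a b de by (intro difference_graph_arcI[OF fin x]) simp_all
  moreover have "(a, inv a) \<notin> parcs (difference_graph G)"
    using difference_graph_no_arc_if_ord_eq[OF fin] aG by simp
  moreover have "a \<noteq> inv a"
    using inv_neq_self_if_ord_gt_2[OF aG] a de by simp
  ultimately have "has_induced (difference_graph G) cycle4"
    using common_neighbour_imp_cycle4[OF fin, of a b "inv a"] b de by simp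
  then show False using C4 by simp
qed

text \<open>An arc would give an element whose order has two distinct odd prime divisors, which none
  of the orders left by \<open>orders_if_no_cycle4\<close> has. This supplies one of the non-arcs of
  the later \<open>two_K2\<close>.\<close>

lemma no_arc_if_odd_prime_ords:
  assumes fin: "finite (carrier G)" and C4: "\<not> has_induced (difference_graph G) cycle4"
    and ab: "ord a = p" "prime p" "p > 2" "ord b = q" "prime q" "q > 2"
  shows "(a, b) \<notin> parcs (difference_graph G)"
proof
  assume "(a, b) \<in> parcs (difference_graph G)"
  then obtain c where c: "c \<in> carrier G" "a \<in> generate G {c}" "b \<in> generate G {c}"
      and nd: "\<not> ord a dvd ord b"
    unfolding difference_graph_arc_iff[OF fin] by (elim bexE conjE)
  have ne: "p \<noteq> q" using nd ab by auto
  have dvd: "p dvd ord c" "q dvd ord c"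
    using ord_dvd_if_in_generate[OF fin c(1,2)] ord_dvd_if_in_generate[OF fin c(1,3)] ab by simp_all
  have unique: False if "prime r" "p dvd r" "q dvd r" for r
    using primes_dvd_imp_eq[OF ab(2) that(1,2)] primes_dvd_imp_eq[OF ab(5) that(1,3)] ne by simp
  from orders_if_no_cycle4[OF fin C4 c(1)] show False
  proof (elim disjE exE conjE)
    assume "ord c = 1"
    then show False using dvd ab by simp
  next
    assume "primepow (ord c)"
    then obtain r m where r: "prime r" "ord c = r ^ m" by (auto simp: primepow_def)
    show False
      using unique[OF r(1)] dvd r(2) prime_dvd_power_nat[OF ab(2)] prime_dvd_power_nat[OF ab(5)] by simp
  next
    fix r assume r: "prime r" "ord c = 2 * r"
    have "\<not> p dvd 2" "\<not> q dvd 2" using ab by (auto dest: dvd_imp_le)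
    then show False
      using unique[OF r(1)] dvd r(2) prime_dvd_mult_iff[OF ab(2)] prime_dvd_mult_iff[OF ab(5)] by simp
  qed
qed

section \<open>Condition B and the shape of the graph\<close>

lemma card_subgroup_dvd:
  assumes "subgroup A G" "subgroup B G" "A \<subseteq> B"
  shows "card A dvd card B"
proof -
  interpret B: group "G\<lparr>carrier := B\<rparr>" using subgroup_imp_group[OF assms(2)] .
  have "subgroup A (G\<lparr>carrier := B\<rparr>)" using subgroup_incl[OF assms] .
  then have "card (rcosets\<^bsub>G\<lparr>carrier := B\<rparr>\<^esub> A) * card A = card B"
    using B.lagrange by (simp add: order_def)
  then show ?thesis by (metis dvd_triv_right)
qed

text \<open>Every arc has an involution of some cyclic subgroup of order \<open>2 * p i\<close> as
  an end, and the intersection condition identifies all these involutions; the common one is the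
  centre.\<close>

lemma condition_B_imp_star:
  assumes fin: "finite (carrier G)" and B: "condition_B G"
  shows "\<exists>t. \<forall>u v. (u, v) \<in> parcs (difference_graph G) \<longrightarrow> u = t \<or> v = t"
  using B unfolding condition_B_def
proof (elim exE conjE)
  fix k :: nat and p :: "nat \<Rightarrow> nat"
  assume p: "\<forall>i\<in>{1..k}. prime (p i) \<and> p i > 2"
    and orders: "\<forall>x\<in>carrier G. ord x = 1 \<or> (\<exists>i\<in>{1..k}. ord x = 2 * p i) \<or> primepow (ord x)"
    and inter: "\<forall>i\<in>{1..k}. \<forall>j\<in>{1..k}. \<forall>H K.
        cyclic_subgroup H G \<and> cyclic_subgroup K G \<and> H \<noteq> K \<and>
        card H = 2 * p i \<and> card K = 2 * p j \<longrightarrow> card (H \<inter> K) = 2"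
  have arc: "\<exists>w\<in>{u, v}. \<exists>i\<in>{1..k}. \<exists>c\<in>carrier G. ord c = 2 * p i \<and> w \<in> generate G {c} \<and> ord w = 2"
    if "(u, v) \<in> parcs (difference_graph G)" for u v
  proof -
    from that obtain c where c: "c \<in> carrier G" "u \<in> generate G {c}" "v \<in> generate G {c}"
        and nd: "\<not> ord u dvd ord v" "\<not> ord v dvd ord u"
      unfolding difference_graph_arc_iff[OF fin] by (elim bexE conjE)
    note dvd = ord_dvd_if_in_generate[OF fin c(1,2)] ord_dvd_if_in_generate[OF fin c(1,3)]
    \<comment> \<open>The divisors of a prime power form a chain, leaving no incomparable
      orders.\<close>
    have "\<not> primepow (ord c)"
    proof
      assume "primepow (ord c)"
      then obtain q m where q: "prime q" "ord c = q ^ m"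
        by (auto simp: primepow_def)
      then obtain i j where ij: "ord u = q ^ i" "ord v = q ^ j"
        using dvd divides_primepow_nat[OF q(1)] by auto
      show False
        using nd le_imp_power_dvd[of i j q] le_imp_power_dvd[of j i q] ij nat_le_linear[of i j] by auto
    qed
    moreover have "ord c \<noteq> 1" using dvd nd by auto
    ultimately obtain i where i: "i \<in> {1..k}" "ord c = 2 * p i" using orders c(1) by auto
    have "ord u \<in> {1, 2, p i, 2 * p i}" "ord v \<in> {1, 2, p i, 2 * p i}"
      using dvd i p dvd_double_prime_nat[of "p i"] by simp_all
    \<comment> \<open>Among the divisors of \<open>2 * p i\<close>, only 2 and \<open>p i\<close>
      are incomparable.\<close>
    then have "ord u = 2 \<or> ord v = 2" using nd by auto
    then obtain w where w: "w \<in> {u, v}" "ord w = 2" by auto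
    moreover from this have "w \<in> generate G {c}" using c by auto
    ultimately show ?thesis
      using i c(1) by (intro bexI[of _ w] bexI[of _ i] bexI[of _ c] conjI)
  qed
  have cyclic: "cyclic_subgroup (generate G {x}) G" if "x \<in> carrier G" for x
    by (rule iffD2[OF cyclic_subgroup_iff_generate[OF is_group]], rule bexI[OF refl that])
  have unique: "w = w'"
    if i: "i \<in> {1..k}" "j \<in> {1..k}" and c: "c \<in> carrier G" "c' \<in> carrier G"
      and o: "ord c = 2 * p i" "ord c' = 2 * p j"
      and w: "w \<in> generate G {c}" "w' \<in> generate G {c'}" "ord w = 2" "ord w' = 2"
    for i j c c' w w'
  proof (cases "generate G {c} = generate G {c'}")
    case True
    then show ?thesis using involution_unique[OF fin c(2), of w w'] w by simp
  next
    case False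
    let ?I = "generate G {c} \<inter> generate G {c'}"
    have I: "card ?I = 2"
      using inter i False cyclic[OF c(1)] cyclic[OF c(2)] generate_pow_card[OF c(1)]
        generate_pow_card[OF c(2)] o by simp
    then have finI: "finite ?I" by (auto intro: card_ge_0_finite)
    \<comment> \<open>The non-identity element \<open>z\<close> of the intersection is an involution
      lying in both subgroups, so it equals both \<open>w\<close> and \<open>w'\<close>.\<close>
    have "\<not> ?I \<subseteq> {\<one>}"
      using I card_mono[of "{\<one>}" ?I] by auto
    then obtain z where z: "z \<in> ?I" "z \<noteq> \<one>" by auto
    have zG: "z \<in> carrier G" using z c generate_in_carrier[of "{c}" z] by simp
    have "generate G {z} \<subseteq> ?I"
      using generate_subset_iff[OF zG c(1)] generate_subset_iff[OF zG c(2)] z by simp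
    then have "ord z \<le> 2"
      using I card_mono[OF finI] generate_pow_card[OF zG] by simp
    moreover have "ord z \<noteq> 1" using ord_eq_1[OF zG] z by simp
    moreover have "ord z \<ge> 1" using ord_ge_1[OF fin zG] .
    ultimately have "ord z = 2" by linarith
    then show ?thesis
      using involution_unique[OF fin c(1), of w z] involution_unique[OF fin c(2), of z w'] z w by simp
  qed
  show "\<exists>t. \<forall>u v. (u, v) \<in> parcs (difference_graph G) \<longrightarrow> u = t \<or> v = t"
  proof (cases "parcs (difference_graph G) = {}")
    case True
    then show ?thesis by simp
  next
    case False
    then obtain u v where "(u, v) \<in> parcs (difference_graph G)" by auto
    from arc[OF this] obtain t i c where t: "i \<in> {1..k}" "c \<in> carrier G" "ord c = 2 * p i"
        "t \<in> generate G {c}" "ord t = 2" by (elim bexE conjE)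
    show ?thesis
    proof (intro exI[of _ t] allI impI)
      fix u' v' assume "(u', v') \<in> parcs (difference_graph G)"
      from arc[OF this] obtain w j c' where w: "w \<in> {u', v'}" "j \<in> {1..k}" "c' \<in> carrier G"
        "ord c' = 2 * p j" "w \<in> generate G {c'}" "ord w = 2" by (elim bexE conjE)
      have "w = t"
        by (rule unique[OF w(2) t(1) w(3) t(2) w(4) t(3) w(5) t(4) w(6) t(5)])
      then show "u' = t \<or> v' = t" using w(1) by auto
    qed
  qed
qed

text \<open>Two cyclic subgroups as in condition B turn out to share their involution, so their
  intersection has even order dividing \<open>2 * p\<close>. The value \<open>2 * p\<close> would
  force \<open>H \<subseteq> K\<close>, then \<open>p = q\<close> and \<open>H = K\<close>.\<close>

lemma condition_BI:
  assumes fin: "finite (carrier G)"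
    and C4: "\<not> has_induced (difference_graph G) cycle4"
    and K2: "\<not> has_induced (difference_graph G) two_K2"
  shows "condition_B G"
proof -
  let ?E = "parcs (difference_graph G)"
  note pg = pair_graph_difference_graph[OF fin]
  have inter: "card (H \<inter> K) = 2"
    if pq: "prime p" "p > 2" "prime q" "q > 2"
      and HK: "cyclic_subgroup H G" "cyclic_subgroup K G" "H \<noteq> K" "card H = 2 * p" "card K = 2 * q"
    for p q :: nat and H K
  proof -
    have odd: "odd p" "odd q"
      using prime_odd_nat[OF pq(1)] prime_odd_nat[OF pq(3)] pq by simp_all
    \<comment> \<open>Powers of a generator of \<open>L\<close> with the incomparable orders 2 and
      \<open>r\<close> give an arc at the involution of \<open>L\<close>.\<close>
    have edge: "\<exists>s a. s \<in> L \<and> ord s = 2 \<and> ord a = r \<and> (s, a) \<in> ?E"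
      if "cyclic_subgroup L G" "card L = 2 * r" "odd r" "r > 2" for L r
    proof -
      from that(1) obtain h where h: "h \<in> carrier G" "L = generate G {h}"
        unfolding cyclic_subgroup_iff_generate[OF is_group] by (elim bexE)
      have oh: "ord h = 2 * r" using generate_pow_card[OF h(1)] h(2) that(2) by simp
      define s a where "s = h [^] (ord h div 2)" and "a = h [^] (ord h div r)"
      have s: "s \<in> generate G {h}" "ord s = 2" and a: "a \<in> generate G {h}" "ord a = r"
        unfolding s_def a_def
        by (rule in_generate_pow_ord_div[OF fin h(1)], simp add: oh)+
      have "\<not> r dvd 2" using \<open>r > 2\<close> by (auto dest: dvd_imp_le)
      then have "(s, a) \<in> ?E"
        using s a \<open>odd r\<close> by (intro difference_graph_arcI[OF fin h(1)]) simp_all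
      then show ?thesis using s a h(2) by (intro exI conjI) simp_all
    qed
    obtain s a where sa: "s \<in> H" "ord s = 2" "ord a = p" "(s, a) \<in> ?E"
      using edge[OF HK(1,4) odd(1) pq(2)] by (elim exE conjE)
    obtain t b where tb: "t \<in> K" "ord t = 2" "ord b = q" "(t, b) \<in> ?E"
      using edge[OF HK(2,5) odd(2) pq(4)] by (elim exE conjE)
    have st: "(s, t) \<notin> ?E" "(t, s) \<notin> ?E"
      using difference_graph_no_arc_if_ord_eq[OF fin] sa tb by simp_all
    have "s = t"
    proof (rule ccontr)
      assume ne: "s \<noteq> t"
      \<comment> \<open>If \<open>s\<close> were also adjacent to \<open>b\<close>, then
        \<open>s\<close> and \<open>t\<close> would be non-adjacent common neighbours of
        \<open>b\<close>, whose order exceeds 2. The case of \<open>t\<close> and \<open>a\<close>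
        is symmetric.\<close>
      have "(s, b) \<notin> ?E"
        using common_neighbour_imp_cycle4[OF fin _ tb(4) ne st(1)] tb(3) pq(4) C4 by auto
      moreover have "(t, a) \<notin> ?E"
        using common_neighbour_imp_cycle4[OF fin _ sa(4) ne[symmetric] st(2)] sa(3) pq(2) C4 by auto
      then have "(a, t) \<notin> ?E"
        using pair_graph_arcD(1)[OF pg, of a t] by auto
      moreover have "(a, b) \<notin> ?E"
        using no_arc_if_odd_prime_ords[OF fin C4 sa(3) pq(1,2) tb(3) pq(3,4)] .
      ultimately have "has_induced (difference_graph G) two_K2"
        using has_induced_two_K2I[OF pg sa(4) tb(4) st(1)] by simp
      then show False using K2 by simp
    qed
    have sub: "subgroup H G" "subgroup K G"
      using HK(1,2) unfolding cyclic_subgroup_def by simp_all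
    have sG: "s \<in> carrier G" using subgroup.mem_carrier[OF sub(1) sa(1)] .
    have fin': "finite H" "finite K" using HK(4,5) pq by (auto intro: card_ge_0_finite)
    have subHK: "subgroup (H \<inter> K) G" using subgroups_Inter_pair[OF sub] .
    have "generate G {s} \<subseteq> H \<inter> K"
      using generate_subgroup_incl[OF _ subHK, of "{s}"] sa(1) tb(1) \<open>s = t\<close> by simp
    then have "2 dvd card (H \<inter> K)"
      using card_subgroup_dvd[OF generate_is_subgroup subHK, of "{s}"] sG generate_pow_card[OF sG] sa(2)
      by simp
    moreover have dvdH: "card (H \<inter> K) dvd 2 * p"
      using card_subgroup_dvd[OF subHK sub(1)] HK(4) by simp
    ultimately have "card (H \<inter> K) = 2 \<or> card (H \<inter> K) = 2 * p"
      using dvd_double_prime_nat[OF pq(1) dvdH] odd by auto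
    moreover have "card (H \<inter> K) \<noteq> 2 * p"
    proof
      assume "card (H \<inter> K) = 2 * p"
      then have "H \<inter> K = H" using card_subset_eq[OF fin'(1), of "H \<inter> K"] HK(4) by simp
      then have HsubK: "H \<subseteq> K" by auto
      then have "p dvd q" using card_subgroup_dvd[OF sub] HK(4,5) by simp
      then have "p = q" using primes_dvd_imp_eq[OF pq(1,3)] by simp
      then have "H = K" using card_subset_eq[OF fin'(2) HsubK] HK(4,5) by simp
      then show False using HK(3) by simp
    qed
    ultimately show ?thesis by simp
  qed
  \<comment> \<open>The primes may repeat and need not all occur in element orders; 3 is a dummy value.\<close>
  define p :: "nat \<Rightarrow> nat" where "p = (\<lambda>i. if prime i \<and> i > 2 then i else 3)"
  have p: "prime (p i)" "p i > 2" for i by (auto simp: p_def)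
  show ?thesis
    unfolding condition_B_def
  \<comment> \<open>A prime \<open>r > 2\<close> is listed at index \<open>r\<close>; the range up
    to \<open>order G\<close> reaches it because \<open>2 * r = ord x\<close> is at most
    \<open>order G\<close>.\<close>
  proof (intro exI[of _ "order G"] exI[of _ p] conjI ballI allI impI)
    fix x assume x: "x \<in> carrier G"
    have "ord x \<le> order G" using ord_le_group_order[OF fin x] .
    then have "\<exists>i\<in>{1..order G}. ord x = 2 * p i" if "r > 2" "prime r" "ord x = 2 * r" for r
      using that by (intro bexI[of _ r]) (auto simp: p_def)
    then show "ord x = 1 \<or> (\<exists>i\<in>{1..order G}. ord x = 2 * p i) \<or> primepow (ord x)"
      using orders_if_no_cycle4[OF fin C4 x] by auto
  next
    fix i j H K
    assume "cyclic_subgroup H G \<and> cyclic_subgroup K G \<and> H \<noteq> K \<and> card H = 2 * p i \<and> card K = 2 * p j"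
    then show "card (H \<inter> K) = 2" using inter[OF p(1,2)[of i] p(1,2)[of j], of H K] by simp
  qed (rule p)+
qed

end

theorem theorem3p11:
  fixes G :: "('a, 'b) monoid_scheme"
  assumes "group G" and "finite (carrier G)" and "\<not> EPPO_group G"
  shows "(threshold_graph (difference_graph G) \<longleftrightarrow> split_graph (difference_graph G)) \<and>
         (split_graph (difference_graph G) \<longleftrightarrow> condition_B G)"
proof -
  interpret group G by fact
  let ?D = "difference_graph G"
  note pg = pair_graph_difference_graph[OF assms(2)]
  have "condition_B G" if "threshold_graph ?D"
    using condition_BI[OF assms(2)] that unfolding threshold_graph_def by simp
  moreover have "condition_B G" if "split_graph ?D"
    using condition_BI[OF assms(2)] split_graph_no_induced[OF pg that] by simp
  moreover have "threshold_graph ?D \<and> split_graph ?D" if B: "condition_B G"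
  proof -
    obtain t where t: "\<forall>u v. (u, v) \<in> parcs ?D \<longrightarrow> u = t \<or> v = t"
      using condition_B_imp_star[OF assms(2) B] ..
    show ?thesis
      using star_threshold_graph[OF pg t[rule_format]] star_split_graph[OF pg t[rule_format]] by simp
  qed
  ultimately show ?thesis by (intro conjI iffI) simp_all
qed

end
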